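(* Let $K$ be a field of characteristic $0$, let $n\geq 1$, and let $F=(F_1,\dots,F_n):K^n\to K^n$ be a triangular polynomial map, i.e. a polynomial map of the form $$F_i(X_1,\dots,X_n)=X_i+H_i(X_{i+1},\dots,X_n)\quad (1\leq i\leq n-1),\qquad F_n(X_1,\dots,X_n)=X_n,$$ where $H_i\in K[X_{i+1},\dots,X_n]$ for $1\leq i\leq n-1$. Then $F$ is nice.
   Context: $K$ is a field of characteristic $0$. A polynomial map $F=(F_1,\dots,F_n):K^n\to K^n$ is a map whose components $F_i$ are in the polynomial ring $K[X_1,\dots,X_n]$. Given such $F$, define for $i=1,\dots,n$ the polynomials $P_0^i=X_i$ and, for $k\geq 1$, $P_k^i(X_1,\dots,X_n)=P_{k-1}^i(F_1,\dots,F_n)-P_{k-1}^i(X_1,\dots,X_n)$ (so $P_1^i=F_i-X_i$). The map $F$ is called nice if there exists an integer $m$ such that $P_m^i=0$ for all $i=1,\dots,n$. *)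

theory Defs
  imports "HOL-Library.Poly_Mapping"
begin

text \<open>
  Polynomials over \<open>'k\<close> are finitely supported maps from monomials to coefficients, where a
  monomial is a finitely supported map from variable indices to exponents; the ring structure is
  the convolution product of \<^theory>\<open>HOL-Library.Poly_Mapping\<close>. The type has countably
  many variables; \<open>K[X\<^sub>1, \<dots>, X\<^sub>n]\<close> is \<open>polys_in {1..n}\<close> below.
\<close>

type_synonym 'k mpoly = "(nat \<Rightarrow>\<^sub>0 nat) \<Rightarrow>\<^sub>0 'k"

definition mp_const :: "'k \<Rightarrow> 'k::comm_ring_1 mpoly" where
  "mp_const c = Poly_Mapping.single 0 c"

definition mp_var :: "nat \<Rightarrow> 'k::comm_ring_1 mpoly" where
  "mp_var i = Poly_Mapping.single (Poly_Mapping.single i 1) 1"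

definition polys_in :: "nat set \<Rightarrow> 'k::comm_ring_1 mpoly set" where
  "polys_in V = {p. \<forall>m \<in> Poly_Mapping.keys p. Poly_Mapping.keys m \<subseteq> V}"

text \<open>\<open>mp_subst F p\<close> is \<open>p(F\<^sub>1, F\<^sub>2, \<dots>)\<close>; only the \<open>F\<^sub>i\<close> for which \<open>X\<^sub>i\<close> occurs in \<open>p\<close> matter.\<close>

definition mp_subst :: "(nat \<Rightarrow> 'k mpoly) \<Rightarrow> 'k::comm_ring_1 mpoly \<Rightarrow> 'k mpoly" where
  "mp_subst F p =
     (\<Sum>m \<in> Poly_Mapping.keys p. mp_const (Poly_Mapping.lookup p m) *
        (\<Prod>i \<in> Poly_Mapping.keys m. F i ^ Poly_Mapping.lookup m i))"

text \<open>
  A polynomial map \<open>K\<^sup>n \<rightarrow> K\<^sup>n\<close> is given by its components \<open>F 1, \<dots>, F n\<close>. The values of \<open>F\<close> at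
  other indices are junk: none of the notions below depends on them when the components lie in
  \<open>polys_in {1..n}\<close>.
\<close>

definition polynomial_map :: "nat \<Rightarrow> (nat \<Rightarrow> 'k::comm_ring_1 mpoly) \<Rightarrow> bool" where
  "polynomial_map n F \<longleftrightarrow> (\<forall>i \<in> {1..n}. F i \<in> polys_in {1..n})"

primrec diff_poly :: "(nat \<Rightarrow> 'k::comm_ring_1 mpoly) \<Rightarrow> nat \<Rightarrow> nat \<Rightarrow> 'k mpoly" where
  "diff_poly F 0 i = mp_var i"
| "diff_poly F (Suc k) i = mp_subst F (diff_poly F k i) - diff_poly F k i"

definition nice :: "nat \<Rightarrow> (nat \<Rightarrow> 'k::comm_ring_1 mpoly) \<Rightarrow> bool" where
  "nice n F \<longleftrightarrow> (\<exists>m. \<forall>i \<in> {1..n}. diff_poly F m i = 0)"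

definition triangular_map :: "nat \<Rightarrow> (nat \<Rightarrow> 'k::comm_ring_1 mpoly) \<Rightarrow> bool" where
  "triangular_map n F \<longleftrightarrow> polynomial_map n F \<and>
     (\<exists>H. (\<forall>i \<in> {1..<n}. H i \<in> polys_in {i+1..n} \<and> F i = mp_var i + H i) \<and> F n = mp_var n)"

lemma mp_subst_var: "mp_subst F (mp_var i) = F i"
  by (simp add: mp_subst_def mp_var_def mp_const_def)

lemma diff_poly_1: "diff_poly F 1 i = F i - mp_var i"
  by (simp add: mp_subst_var)

end

theory Submission imports Defs begin

text \<open>
  Write \<open>\<sigma>\<close> for substitution of \<open>F\<close> and \<open>\<Delta> = \<sigma> - id\<close>. Since \<open>\<sigma>\<close> is a ring homomorphism,
  \<open>\<Delta>(pq) = \<Delta>p \<cdot> q + p \<cdot> \<Delta>q + \<Delta>p \<cdot> \<Delta>q\<close>, so the polynomials killed by some power of \<open>\<Delta>\<close> form a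
  subalgebra. It contains \<open>X\<^sub>n\<close> because \<open>\<Delta>X\<^sub>n = 0\<close>, and then, by descending induction on \<open>i\<close>,
  it contains \<open>X\<^sub>i\<close> because \<open>\<Delta>X\<^sub>i = H\<^sub>i\<close> is a polynomial in variables already treated.
\<close>

lemma poly_mapping_eq_sum_single:
  "p = (\<Sum>m \<in> Poly_Mapping.keys p. Poly_Mapping.single m (Poly_Mapping.lookup p m))"
  by (rule poly_mapping_eqI)
    (auto simp: lookup_sum lookup_single when_def in_keys_iff)

text \<open>Every polynomial is a finite sum of terms, so a property closed under addition need only
  be checked on terms; \<open>P 0\<close> comes from the term with coefficient
  \<open>0\<close>.\<close>

lemma mpoly_additive_induct [case_names single add]:
  fixes p :: "'k::comm_ring_1 mpoly"
  assumes "\<And>m c. P (Poly_Mapping.single m c)" and "\<And>p q. P p \<Longrightarrow> P q \<Longrightarrow> P (p + q)"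
  shows "P p"
proof -
  have "P 0"
    using assms(1)[of 0 0] by simp
  then have "P (\<Sum>m \<in> A. Poly_Mapping.single m (Poly_Mapping.lookup p m))" for A
    by (induction A rule: infinite_finite_induct) (auto intro: assms)
  then show ?thesis
    using poly_mapping_eq_sum_single[of p] by metis
qed

lemma mp_var_power: "mp_var i ^ k = Poly_Mapping.single (Poly_Mapping.single i k) 1"
  by (induction k) (simp_all add: mp_var_def mult_single flip: single_add)

text \<open>The exponent vector \<open>m\<close> is itself a finitely supported map, hence a sum of
  singles, and multiplying terms adds their exponents.\<close>

lemma single_eq_const_times_vars:
  "Poly_Mapping.single m c =
    mp_const c * (\<Prod>i \<in> Poly_Mapping.keys m. mp_var i ^ Poly_Mapping.lookup m i)"
proof -
  have "(\<Prod>i \<in> A. Poly_Mapping.single (f i) (1 :: 'a)) = Poly_Mapping.single (\<Sum>i \<in> A. f i) 1"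
    for f :: "nat \<Rightarrow> nat \<Rightarrow>\<^sub>0 nat" and A
    by (induction A rule: infinite_finite_induct) (simp_all add: mult_single)
  then show ?thesis
    by (simp add: mp_var_power mp_const_def mult_single flip: poly_mapping_eq_sum_single)
qed

lemma mp_subst_single:
  "mp_subst F (Poly_Mapping.single m c) =
    mp_const c * (\<Prod>i \<in> Poly_Mapping.keys m. F i ^ Poly_Mapping.lookup m i)"
  by (cases "c = 0") (simp_all add: mp_subst_def mp_const_def)

lemma mp_subst_const: "mp_subst F (mp_const c) = mp_const c"
  using mp_subst_single[of F 0 c] by (simp add: mp_const_def)

text \<open>Cancellation can shrink the keys of \<open>p + q\<close>; this is harmless because a
  zero coefficient contributes \<open>0\<close> to the sum.\<close>

lemma mp_subst_add: "mp_subst F (p + q) = mp_subst F p + mp_subst F q"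
  unfolding mp_subst_def
  by (rule setsum_keys_plus_distrib) (simp_all add: mp_const_def single_add distrib_right)

lemma prod_keys_power_add:
  fixes F :: "nat \<Rightarrow> 'a::comm_monoid_mult"
  shows "(\<Prod>i \<in> Poly_Mapping.keys (m + m'). F i ^ Poly_Mapping.lookup (m + m') i) =
    (\<Prod>i \<in> Poly_Mapping.keys m. F i ^ Poly_Mapping.lookup m i) *
    (\<Prod>i \<in> Poly_Mapping.keys m'. F i ^ Poly_Mapping.lookup m' i)"
proof -
  \<comment> \<open>The three products run over different key sets. On the common index set
    \<open>A\<close> the extra factors have exponent \<open>0\<close>, hence equal
    \<open>1\<close>.\<close>
  define A where "A = Poly_Mapping.keys m \<union> Poly_Mapping.keys m'"
  have A: "(\<Prod>i \<in> Poly_Mapping.keys l. F i ^ Poly_Mapping.lookup l i) =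
      (\<Prod>i \<in> A. F i ^ Poly_Mapping.lookup l i)" if "Poly_Mapping.keys l \<subseteq> A" for l
    by (rule prod.mono_neutral_left) (use that in \<open>auto simp: A_def in_keys_iff\<close>)
  have "Poly_Mapping.keys (m + m') \<subseteq> A"
    unfolding A_def by (rule Poly_Mapping.keys_add)
  then show ?thesis
    using A[of m] A[of m'] A[of "m + m'"]
    by (simp add: A_def lookup_add power_add prod.distrib)
qed

text \<open>Both sides are additive in \<open>p\<close> and in \<open>q\<close>, which leaves the
  case of two terms, whose exponents add.\<close>

lemma mp_subst_mult: "mp_subst F (p * q) = mp_subst F p * mp_subst F q"
proof (induction p rule: mpoly_additive_induct)
  case (single m c)
  show ?case
  proof (induction q rule: mpoly_additive_induct)
    case (single m' c')
    have "mp_const (c * c') = mp_const c * mp_const c'"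
      by (simp add: mp_const_def mult_single)
    then show ?case
      by (simp add: mult_single mp_subst_single prod_keys_power_add mult_ac)
  qed (simp add: distrib_left mp_subst_add)
qed (simp add: distrib_right mp_subst_add)

definition mp_diff :: "(nat \<Rightarrow> 'k mpoly) \<Rightarrow> 'k::comm_ring_1 mpoly \<Rightarrow> 'k mpoly" where
  "mp_diff F p = mp_subst F p - p"

text \<open>As iterates of one operator, the recursion can be studied on arbitrary polynomials, in
  particular on products.\<close>

lemma diff_poly_eq_funpow: "diff_poly F k i = (mp_diff F ^^ k) (mp_var i)"
  by (induction k) (simp_all add: mp_diff_def)

lemma mp_diff_add: "mp_diff F (p + q) = mp_diff F p + mp_diff F q"
  by (simp add: mp_diff_def mp_subst_add)

lemma mp_diff_zero: "mp_diff F 0 = 0"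
  using mp_diff_add[of F 0 0] by simp

lemma mp_diff_mult:
  "mp_diff F (p * q) = mp_diff F p * q + p * mp_diff F q + mp_diff F p * mp_diff F q"
  by (simp add: mp_diff_def mp_subst_mult algebra_simps)

lemma funpow_mp_diff_add:
  "(mp_diff F ^^ k) (p + q) = (mp_diff F ^^ k) p + (mp_diff F ^^ k) q"
  by (induction k) (simp_all add: mp_diff_add)

lemma funpow_mp_diff_zero: "(mp_diff F ^^ k) 0 = 0"
  by (induction k) (simp_all add: mp_diff_zero)

lemma funpow_mp_diff_mono:
  assumes "(mp_diff F ^^ k) p = 0" and "k \<le> l"
  shows "(mp_diff F ^^ l) p = 0"
proof -
  have "(mp_diff F ^^ l) p = (mp_diff F ^^ (l - k)) ((mp_diff F ^^ k) p)"
    using assms(2) by (simp flip: funpow_add comp_apply[of "_ ^^ _"])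
  then show ?thesis
    by (simp add: assms(1) funpow_mp_diff_zero)
qed

text \<open>Induction on \<open>a + b\<close>: the product rule turns one application of
  \<open>mp_diff F\<close> into three products, each with a smaller total exponent.\<close>

lemma funpow_mp_diff_mult:
  assumes "(mp_diff F ^^ a) p = 0" and "(mp_diff F ^^ b) q = 0"
  shows "(mp_diff F ^^ (a + b)) (p * q) = 0"
  using assms
proof (induction "a + b" arbitrary: a b p q rule: less_induct)
  case less
  show ?case
  \<comment> \<open>An exponent \<open>0\<close> means that the factor itself is
    \<open>0\<close>.\<close>
  proof (cases "a = 0 \<or> b = 0")
    case True
    then show ?thesis
      using less.prems by (auto simp: funpow_mp_diff_zero)
  next
    case False
    then obtain a' b' where [simp]: "a = Suc a'" "b = Suc b'"
      by (metis not0_implies_Suc)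
    have p: "(mp_diff F ^^ a') (mp_diff F p) = 0" and q: "(mp_diff F ^^ b') (mp_diff F q) = 0"
      using less.prems by (simp_all add: funpow_swap1)
    have "(mp_diff F ^^ (a' + b)) (mp_diff F p * q) = 0"
      by (rule less.hyps) (use p less.prems in auto)
    moreover have "(mp_diff F ^^ (a + b')) (p * mp_diff F q) = 0"
      by (rule less.hyps) (use q less.prems in auto)
    moreover have "(mp_diff F ^^ (a' + b')) (mp_diff F p * mp_diff F q) = 0"
      by (rule less.hyps) (use p q in auto)
    \<comment> \<open>This product already vanishes after \<open>a' + b'\<close> steps; it is raised
      to the exponent \<open>a' + b = a + b' = Suc (a' + b')\<close> of the other two.\<close>
    then have "(mp_diff F ^^ Suc (a' + b')) (mp_diff F p * mp_diff F q) = 0"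
      by (rule funpow_mp_diff_mono) simp
    ultimately have "(mp_diff F ^^ Suc (a' + b')) (mp_diff F (p * q)) = 0"
      by (simp add: mp_diff_mult funpow_mp_diff_add del: funpow.simps)
    then show ?thesis
      by (simp add: funpow_swap1)
  qed
qed

definition diff_nilpotent :: "(nat \<Rightarrow> 'k::comm_ring_1 mpoly) \<Rightarrow> 'k mpoly set" where
  "diff_nilpotent F = {p. \<exists>k. (mp_diff F ^^ k) p = 0}"

text \<open>The larger of the two exponents kills both summands.\<close>

lemma diff_nilpotent_add:
  assumes "p \<in> diff_nilpotent F" and "q \<in> diff_nilpotent F"
  shows "p + q \<in> diff_nilpotent F"
proof -
  obtain a b where "(mp_diff F ^^ a) p = 0" "(mp_diff F ^^ b) q = 0"
    using assms by (auto simp: diff_nilpotent_def)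
  then have "(mp_diff F ^^ max a b) (p + q) = 0"
    using funpow_mp_diff_mono[of a F p "max a b"] funpow_mp_diff_mono[of b F q "max a b"]
    by (simp add: funpow_mp_diff_add)
  then show ?thesis
    by (auto simp: diff_nilpotent_def)
qed

lemma diff_nilpotent_mult:
  assumes "p \<in> diff_nilpotent F" and "q \<in> diff_nilpotent F"
  shows "p * q \<in> diff_nilpotent F"
  using assms funpow_mp_diff_mult unfolding diff_nilpotent_def by blast

lemma diff_nilpotent_const: "mp_const c \<in> diff_nilpotent F"
proof -
  have "(mp_diff F ^^ 1) (mp_const c) = 0"
    by (simp add: mp_diff_def mp_subst_const)
  then show ?thesis
    unfolding diff_nilpotent_def by blast
qed

lemma diff_nilpotent_zero: "0 \<in> diff_nilpotent F"
  using diff_nilpotent_const[of 0 F] by (simp add: mp_const_def)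

lemma diff_nilpotent_one: "1 \<in> diff_nilpotent F"
  using diff_nilpotent_const[of 1 F] by (simp add: mp_const_def)

lemma diff_nilpotent_power: "p \<in> diff_nilpotent F \<Longrightarrow> p ^ k \<in> diff_nilpotent F"
  by (induction k) (simp_all add: diff_nilpotent_one diff_nilpotent_mult)

lemma diff_nilpotent_sum:
  "(\<And>x. x \<in> A \<Longrightarrow> f x \<in> diff_nilpotent F) \<Longrightarrow> sum f A \<in> diff_nilpotent F"
  by (induction A rule: infinite_finite_induct)
    (simp_all add: diff_nilpotent_zero diff_nilpotent_add)

lemma diff_nilpotent_prod:
  "(\<And>x. x \<in> A \<Longrightarrow> f x \<in> diff_nilpotent F) \<Longrightarrow> prod f A \<in> diff_nilpotent F"
  by (induction A rule: infinite_finite_induct)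
    (simp_all add: diff_nilpotent_one diff_nilpotent_mult)

text \<open>Constants and the given variables generate these polynomials by sums and products, under
  which \<open>diff_nilpotent F\<close> is closed.\<close>

lemma polys_in_subset_diff_nilpotent:
  fixes F :: "nat \<Rightarrow> 'a::comm_ring_1 mpoly"
  assumes "\<And>i. i \<in> V \<Longrightarrow> mp_var i \<in> diff_nilpotent F"
  shows "polys_in V \<subseteq> diff_nilpotent F"
proof
  fix p :: "'a mpoly"
  assume p: "p \<in> polys_in V"
  have "(\<Sum>m \<in> Poly_Mapping.keys p. Poly_Mapping.single m (Poly_Mapping.lookup p m))
      \<in> diff_nilpotent F"
  proof (rule diff_nilpotent_sum)
    fix m
    assume "m \<in> Poly_Mapping.keys p"
    then have "Poly_Mapping.keys m \<subseteq> V"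
      using p by (simp add: polys_in_def)
    then show "Poly_Mapping.single m (Poly_Mapping.lookup p m) \<in> diff_nilpotent F"
      by (subst single_eq_const_times_vars)
        (auto intro!: diff_nilpotent_mult diff_nilpotent_const diff_nilpotent_prod
          diff_nilpotent_power assms)
  qed
  then show "p \<in> diff_nilpotent F"
    by (simp flip: poly_mapping_eq_sum_single)
qed

text \<open>One extra application of the operator suffices. This carries nilpotency from
  \<open>H i\<close> back to \<open>mp_var i\<close>.\<close>

lemma diff_nilpotent_if_mp_diff:
  assumes "mp_diff F p \<in> diff_nilpotent F"
  shows "p \<in> diff_nilpotent F"
proof -
  obtain k where "(mp_diff F ^^ k) (mp_diff F p) = 0"
    using assms by (auto simp: diff_nilpotent_def)
  then have "(mp_diff F ^^ Suc k) p = 0"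
    by (simp add: funpow_swap1)
  then show ?thesis
    unfolding diff_nilpotent_def by blast
qed

lemma triangular_map_var_diff_nilpotent:
  assumes "triangular_map n F" and "i \<in> {1..n}"
  shows "mp_var i \<in> diff_nilpotent F"
  using assms(2)
proof (induction "n - i" arbitrary: i rule: less_induct)
  case less
  obtain H where H: "\<And>j. j \<in> {1..<n} \<Longrightarrow> H j \<in> polys_in {j+1..n} \<and> F j = mp_var j + H j"
    and Fn: "F n = mp_var n"
    using assms(1) unfolding triangular_map_def by blast
  have "mp_diff F (mp_var i) \<in> diff_nilpotent F"
  proof (cases "i = n")
    case True
    then show ?thesis
      by (simp add: mp_diff_def mp_subst_var Fn diff_nilpotent_zero)
  next
    case False
    then have i: "i \<in> {1..<n}"
      using less.prems by auto
    have "polys_in {i+1..n} \<subseteq> diff_nilpotent F"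
      \<comment> \<open>Each \<open>j\<close> in \<open>{i+1..n}\<close> has
        \<open>n - j < n - i\<close>, so the induction hypothesis covers its variable.\<close>
      by (rule polys_in_subset_diff_nilpotent, rule less.hyps) auto
    then show ?thesis
      using H[OF i] by (auto simp: mp_diff_def mp_subst_var)
  qed
  then show ?case
    by (rule diff_nilpotent_if_mp_diff)
qed

theorem theorem4:
  fixes F :: "nat \<Rightarrow> 'k::field_char_0 mpoly" and n :: nat
  assumes "n \<ge> 1" and "triangular_map n F"
  shows "nice n F"
proof -
  have "\<forall>i \<in> {1..n}. \<exists>k. (mp_diff F ^^ k) (mp_var i) = 0"
    using triangular_map_var_diff_nilpotent[OF assms(2)] by (auto simp: diff_nilpotent_def)
  then obtain k where k: "\<And>i. i \<in> {1..n} \<Longrightarrow> (mp_diff F ^^ k i) (mp_var i) = 0"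
    by metis
  \<comment> \<open>The exponents \<open>k i\<close> vary with \<open>i\<close>, while niceness asks
    for a single one; their maximum serves all indices.\<close>
  have "diff_poly F (Max (k ` {1..n})) i = 0" if "i \<in> {1..n}" for i
    unfolding diff_poly_eq_funpow
    by (rule funpow_mp_diff_mono[OF k[OF that]]) (use that in auto)
  then show ?thesis
    unfolding nice_def by blast
qed

end
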